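(* Any quiver on $n\le 3$ vertices possesses a proper cyclic ordering.
   Context: A quiver is a finite directed graph without loops or oriented 2-cycles; multiple arrows are allowed. A cyclic ordering $\sigma=(v_1,\dots,v_n)$ of the vertex set is a linear ordering considered up to cyclic shifts ("clockwise" placement on a circle). A cyclically ordered quiver (COQ) $(Q,\sigma)$ is a quiver with a cyclic ordering of its vertices. A wiggle transforms $(Q,\sigma)$ into $(Q,\sigma')$ where $\sigma'$ is obtained from $\sigma$ by interchanging two vertices that are consecutive in $\sigma$ and not adjacent in $Q$. Wiggle equivalence is the equivalence relation generated by wiggles. A path $i\to j\to k$ in $Q$ makes a right turn at $j$ if $\sigma=(\dots,i,\dots,j,\dots,k,\dots)$. A vertex $j$ is proper in $(Q,\sigma)$ if every oriented two-arrow path $i\to j\to k$ in $Q$ makes a right turn at $j$. A COQ $(Q,\sigma)$ is proper if for every vertex $j$ there is a COQ wiggle equivalent to $(Q,\sigma)$ (possibly depending on $j$) in which $j$ is proper. A proper cyclic ordering of $Q$ is a cyclic ordering $\sigma$ such that $(Q,\sigma)$ is proper. *)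

theory Defs
  imports Graph_Theory.Digraph "HOL-Library.Sublist"
begin

text \<open>Digraphs of AFP Graph Theory carry a set of arcs with head and tail maps, so multiple
  arrows are allowed. The empty quiver is included.\<close>

locale quiver = fin_digraph Q + loopfree_digraph Q for Q :: "('a, 'b) pre_digraph" (structure) +
  assumes no_2_cycles: "u \<rightarrow>\<^bsub>Q\<^esub> v \<Longrightarrow> \<not> v \<rightarrow>\<^bsub>Q\<^esub> u"

definition cyclic_shift :: "('a list \<times> 'a list) set" where
  "cyclic_shift = {(xs, ys). \<exists>k. ys = rotate k xs}"

text \<open>A cyclic ordering is the class, under cyclic shifts, of a linear ordering of \<open>V\<close>;
  its elements are the linear orderings obtained by cutting the circle open.\<close>

definition cyclic_orderings :: "'a set \<Rightarrow> 'a list set set" where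
  "cyclic_orderings V = {xs. distinct xs \<and> set xs = V} // cyclic_shift"

locale coq = quiver Q for Q :: "('a, 'b) pre_digraph" (structure) +
  fixes \<sigma> :: "'a list set"
  assumes cyclic_ordering: "\<sigma> \<in> cyclic_orderings (verts Q)"

text \<open>Since all cyclic shifts are available in \<open>\<sigma>\<close>, two vertices are consecutive in \<open>\<sigma>\<close>
  iff they are the first two entries of some representative.\<close>

definition wiggle :: "('a, 'b) pre_digraph \<Rightarrow> 'a list set \<Rightarrow> 'a list set \<Rightarrow> bool" where
  "wiggle Q \<sigma> \<sigma>' \<longleftrightarrow> coq Q \<sigma> \<and> coq Q \<sigma>' \<and>
     (\<exists>u v ws. u # v # ws \<in> \<sigma> \<and> v # u # ws \<in> \<sigma>' \<and> \<not> u \<rightarrow>\<^bsub>Q\<^esub> v \<and> \<not> v \<rightarrow>\<^bsub>Q\<^esub> u)"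

definition wiggle_equivalent :: "('a, 'b) pre_digraph \<Rightarrow> 'a list set \<Rightarrow> 'a list set \<Rightarrow> bool" where
  "wiggle_equivalent Q = equivclp (wiggle Q)"

definition right_turn :: "'a list set \<Rightarrow> 'a \<Rightarrow> 'a \<Rightarrow> 'a \<Rightarrow> bool" where
  "right_turn \<sigma> i j k \<longleftrightarrow> (\<exists>xs\<in>\<sigma>. subseq [i, j, k] xs)"

definition proper_vertex :: "('a, 'b) pre_digraph \<Rightarrow> 'a list set \<Rightarrow> 'a \<Rightarrow> bool" where
  "proper_vertex Q \<sigma> j \<longleftrightarrow> (\<forall>i k. i \<rightarrow>\<^bsub>Q\<^esub> j \<and> j \<rightarrow>\<^bsub>Q\<^esub> k \<longrightarrow> right_turn \<sigma> i j k)"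

definition proper_coq :: "('a, 'b) pre_digraph \<Rightarrow> 'a list set \<Rightarrow> bool" where
  "proper_coq Q \<sigma> \<longleftrightarrow> coq Q \<sigma> \<and>
     (\<forall>j\<in>verts Q. \<exists>\<sigma>'. wiggle_equivalent Q \<sigma> \<sigma>' \<and> proper_vertex Q \<sigma>' j)"

definition proper_cyclic_ordering :: "('a, 'b) pre_digraph \<Rightarrow> 'a list set \<Rightarrow> bool" where
  "proper_cyclic_ordering Q \<sigma> \<longleftrightarrow> \<sigma> \<in> cyclic_orderings (verts Q) \<and> proper_coq Q \<sigma>"

end

theory Submission
  imports Defs
begin

text \<open>If \<open>Q\<close> has no two-arrow path, any ordering works. Otherwise the three
  vertices of a path from i through j to k are distinct (\<open>path_distinct\<close>) and hence are
  all of \<open>Q\<close>. Placed clockwise as i, j, k, they leave only clockwise two-arrow paths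
  (\<open>proper_vertex_triple\<close>).\<close>

lemma cyclic_orderings_orbit:
  assumes "distinct xs" and "set xs = V"
  shows "range (\<lambda>n. rotate n xs) \<in> cyclic_orderings V"
proof -
  have "cyclic_shift `` {xs} = range (\<lambda>n. rotate n xs)"
    by (auto simp: cyclic_shift_def)
  with assms show ?thesis
    unfolding cyclic_orderings_def by (metis (mono_tags, lifting) mem_Collect_eq quotientI)
qed

text \<open>Wiggle equivalence is reflexive, so \<sigma> itself serves as the witness for each
  vertex.\<close>

lemma proper_cyclic_orderingI:
  assumes "quiver Q" and "\<sigma> \<in> cyclic_orderings (verts Q)"
    and "\<And>j. j \<in> verts Q \<Longrightarrow> proper_vertex Q \<sigma> j"
  shows "proper_cyclic_ordering Q \<sigma>"
  using assms
  by (auto simp: proper_cyclic_ordering_def proper_coq_def wiggle_equivalent_def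
      coq_def coq_axioms_def intro: equivclp_refl)

lemma right_turn_orbit_triple:
  assumes "(a, b, c) \<in> {(i, j, k), (j, k, i), (k, i, j)}"
  shows "right_turn (range (\<lambda>n. rotate n [i, j, k])) a b c"
proof -
  have "[a, b, c] \<in> {rotate 0 [i, j, k], rotate 1 [i, j, k], rotate 2 [i, j, k]}"
    using assms by (auto simp: numeral_2_eq_2)
  then show ?thesis
    unfolding right_turn_def by blast
qed

text \<open>Consecutive vertices differ because there are no loops; equal endpoints would give an
  oriented 2-cycle.\<close>

lemma (in quiver) path_distinct:
  assumes "a \<rightarrow> b" and "b \<rightarrow> c"
  shows "distinct [a, b, c]"
  using assms no_2_cycles by auto

text \<open>Only the pair k, i is left open: arrows from k to i close an oriented 3-cycle, whose
  paths are all clockwise, while arrows from i to k add no two-arrow path.\<close>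

lemma (in quiver) proper_vertex_triple:
  assumes "i \<rightarrow> j" and "j \<rightarrow> k" and "verts Q = {i, j, k}"
  shows "proper_vertex Q (range (\<lambda>n. rotate n [i, j, k])) v"
  unfolding proper_vertex_def
proof (intro allI impI, elim conjE)
  fix a c assume ac: "a \<rightarrow> v" "v \<rightarrow> c"
  have "a \<in> {i, j, k}" "v \<in> {i, j, k}" "c \<in> {i, j, k}"
    using ac assms(3) adj_in_verts by blast+
  moreover have "distinct [a, v, c]"
    using ac by (rule path_distinct)
  moreover have "\<not> j \<rightarrow> i" "\<not> k \<rightarrow> j"
    using assms no_2_cycles by blast+
  \<comment> \<open>An anticlockwise path uses two of the three pairs ij, jk, ki, hence reverses ij or jk.\<close>
  ultimately have "(a, v, c) \<in> {(i, j, k), (j, k, i), (k, i, j)}"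
    using ac by auto
  then show "right_turn (range (\<lambda>n. rotate n [i, j, k])) a v c"
    by (rule right_turn_orbit_triple)
qed

theorem proposition11p7:
  fixes Q :: "('a, 'b) pre_digraph"
  assumes "quiver Q" and "card (verts Q) \<le> 3"
  shows "\<exists>\<sigma>. proper_cyclic_ordering Q \<sigma>"
proof -
  interpret quiver Q by fact
  show ?thesis
  proof (cases "\<exists>i j k. i \<rightarrow>\<^bsub>Q\<^esub> j \<and> j \<rightarrow>\<^bsub>Q\<^esub> k")
    case True
    then obtain i j k where path: "i \<rightarrow>\<^bsub>Q\<^esub> j" "j \<rightarrow>\<^bsub>Q\<^esub> k" by blast
    have dist: "distinct [i, j, k]"
      using path by (rule path_distinct)
    have "{i, j, k} \<subseteq> verts Q"
      using path adj_in_verts by blast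
    moreover have "card {i, j, k} = 3"
      using dist by auto
    \<comment> \<open>The only use of the bound 3: a path of three distinct vertices exhausts
      \<open>Q\<close>.\<close>
    ultimately have V: "verts Q = {i, j, k}"
      using assms(2) by (metis card_seteq finite_verts)
    show ?thesis
    proof (intro exI proper_cyclic_orderingI)
      show "range (\<lambda>n. rotate n [i, j, k]) \<in> cyclic_orderings (verts Q)"
        using dist by (rule cyclic_orderings_orbit) (simp add: V)
      show "proper_vertex Q (range (\<lambda>n. rotate n [i, j, k])) v" for v
        using path V by (rule proper_vertex_triple)
    qed fact
  next
    case False
    obtain xs where xs: "set xs = verts Q" "distinct xs"
      using finite_distinct_list finite_verts by blast
    show ?thesis
    proof (intro exI proper_cyclic_orderingI)
      show "range (\<lambda>n. rotate n xs) \<in> cyclic_orderings (verts Q)"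
        using xs(2,1) by (rule cyclic_orderings_orbit)
      show "proper_vertex Q (range (\<lambda>n. rotate n xs)) v" for v
        \<comment> \<open>Vacuous: there is no two-arrow path to test.\<close>
        using False by (auto simp: proper_vertex_def)
    qed fact
  qed
qed

end
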